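(* For each real number $u>0$, $$1=\lim_{m\to\infty}\sum_{k=1}^{m}\binom{m}{k}\frac{(-1)^{k+1}}{ku+1}.$$
   Context: Here $m$ ranges over the positive integers and $\binom{m}{k}$ denotes the binomial coefficient. *)

theory Defs
  imports Complex_Main
begin

end

theory Submission
  imports Defs "HOL-Analysis.Gamma_Function"
begin

text \<open>
  Put $x = 1/u$. Up to sign and the factor $x$, the sum is the partial fraction expansion of
  $m! / (x (x+1) \cdots (x+m))$ with the term for $k = 0$ left out, and that omitted term
  contributes exactly $1$. Hence the sum equals
  $1 - x\, m! / (x (x+1) \cdots (x+m))$ (\<open>binomial_partial_fractions\<close>).
  By Euler's product formula $m! \, m^x / (x (x+1) \cdots (x+m)) \to \Gamma(x)$, so the
  remaining quotient decays like $\Gamma(x)\, m^{-x}$, which tends to $0$ because $x > 0$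
  (\<open>fact_over_pochhammer_tendsto_0\<close>).
\<close>

text \<open>
  Pascal's rule makes the left-hand side, as a function of \<open>m\<close> and \<open>x\<close>, satisfy
  $S_{m+1}(x) = S_m(x) - S_m(x+1)$: it is, up to sign, the \<open>m\<close>-th finite difference of $1/x$.
  The right-hand side obeys the same recursion, since
  $1/x - 1/(x+m+1) = (m+1) / (x (x+m+1))$.
\<close>

lemma binomial_partial_fractions:
  fixes x :: "'a :: field_char_0"
  assumes "\<And>k. k \<le> m \<Longrightarrow> x + of_nat k \<noteq> 0"
  shows "(\<Sum>k\<le>m. of_nat (m choose k) * (-1) ^ k / (x + of_nat k)) =
           fact m / pochhammer x (Suc m)"
  using assms
proof (induction m arbitrary: x)
  case 0
  then show ?case by simp
next
  case (Suc m)
  let ?S = "\<lambda>x::'a. \<Sum>k\<le>m. of_nat (m choose k) * (-1) ^ k / (x + of_nat k)"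
  have x: "x \<noteq> 0" using Suc.prems[of 0] by simp
  have xm: "x + 1 + of_nat m \<noteq> 0" using Suc.prems[of "Suc m"] by (simp add: add_ac)
  have IH: "?S x = fact m / pochhammer x (Suc m)"
    using Suc.prems by (intro Suc.IH) simp
  have "x + 1 + of_nat k \<noteq> 0" if "k \<le> m" for k
    using Suc.prems[of "Suc k"] that by (simp add: add_ac)
  then have IH': "?S (x + 1) = fact m / pochhammer (x + 1) (Suc m)"
    by (rule Suc.IH)
  have "(\<Sum>k\<le>Suc m. of_nat (Suc m choose k) * (-1) ^ k / (x + of_nat k)) =
          1 / x + (\<Sum>k\<le>m. of_nat (m choose Suc k) * (-1) ^ Suc k / (x + of_nat (Suc k)))
          - ?S (x + 1)"
    by (subst sum.atMost_Suc_shift)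
       (simp add: sum.distrib sum_subtractf sum_negf ring_distribs add_divide_distrib
          diff_divide_distrib add_ac)
  also have "1 / x + (\<Sum>k\<le>m. of_nat (m choose Suc k) * (-1) ^ Suc k / (x + of_nat (Suc k))) =
      (\<Sum>k\<le>Suc m. of_nat (m choose k) * (-1) ^ k / (x + of_nat k))"
    by (subst sum.atMost_Suc_shift) simp
  also have "\<dots> = ?S x" by simp
  also have "?S x - ?S (x + 1) =
      fact m / pochhammer (x + 1) m * (1 / x - 1 / (x + 1 + of_nat m))"
    unfolding IH IH' pochhammer_rec[of x m] pochhammer_rec'[of "x + 1" m]
    by (simp add: right_diff_distrib mult_ac)
  also have "1 / x - 1 / (x + 1 + of_nat m) = of_nat (Suc m) / (x * (x + 1 + of_nat m))"
    using x xm by (simp add: field_simps)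
  also have "fact m / pochhammer (x + 1) m * \<dots> = fact (Suc m) / pochhammer x (Suc (Suc m))"
    unfolding pochhammer_rec[of x "Suc m"] pochhammer_rec'[of "x + 1" m]
    by (simp add: mult_ac)
  finally show ?case .
qed

lemma fact_over_pochhammer_tendsto_0:
  fixes x :: real
  assumes "x > 0"
  shows "(\<lambda>n. fact n / pochhammer x (Suc n)) \<longlonglongrightarrow> 0"
proof -
  have "(\<lambda>n. Gamma_series x n * real n powr (- x)) \<longlonglongrightarrow> Gamma x * 0"
    using assms
    by (intro tendsto_mult Gamma_series_LIMSEQ tendsto_neg_powr filterlim_real_sequentially) auto
  moreover have "\<forall>\<^sub>F n in sequentially.
      Gamma_series x n * real n powr (- x) = fact n / pochhammer x (Suc n)"
    using eventually_gt_at_top[of 0]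
    by eventually_elim (simp add: Gamma_series_def powr_def flip: exp_add)
  ultimately show ?thesis
    using Lim_transform_eventually by fastforce
qed

theorem theorem1:
  fixes u :: real
  assumes "u > 0"
  shows "(\<lambda>m::nat. \<Sum>k=1..m. real (m choose k) * ((-1) ^ (k + 1) / (real k * u + 1)))
           \<longlonglongrightarrow> 1"
proof -
  define x where "x = 1 / u"
  have x: "x > 0" using assms by (simp add: x_def)
  have "(\<Sum>k=1..m. real (m choose k) * ((-1) ^ (k + 1) / (real k * u + 1))) =
          1 - x * (fact m / pochhammer x (Suc m))" for m
  proof -
    let ?f = "\<lambda>k. real (m choose k) * (-1) ^ k / (x + real k)"
    have "(\<Sum>k=1..m. real (m choose k) * ((-1) ^ (k + 1) / (real k * u + 1))) =
            - x * (\<Sum>k=1..m. ?f k)"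
    proof (unfold sum_distrib_left, rule sum.cong[OF refl])
      fix k
      have "real k * u + 1 = (x + real k) / x"
        using assms by (simp add: x_def field_simps)
      then show "real (m choose k) * ((-1) ^ (k + 1) / (real k * u + 1)) = - x * ?f k"
        by simp
    qed
    also have "(\<Sum>k=1..m. ?f k) = (\<Sum>k\<le>m. ?f k) - 1 / x"
      by (simp add: atMost_atLeast0 sum.atLeast_Suc_atMost)
    also have "(\<Sum>k\<le>m. ?f k) = fact m / pochhammer x (Suc m)"
      using x by (intro binomial_partial_fractions) auto
    finally show ?thesis using x by (simp add: algebra_simps)
  qed
  moreover have "(\<lambda>m. 1 - x * (fact m / pochhammer x (Suc m))) \<longlonglongrightarrow> 1 - x * 0"
    using x by (intro tendsto_intros fact_over_pochhammer_tendsto_0)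
  ultimately show ?thesis by simp
qed

end
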